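(* Let $p(x,y), g(x,y) \in \mathbb{R}[x,y]$ be two polynomials that have the same zero set in $\mathbb{R}^2$, and let $n = \deg_y p$. If there are infinitely many vertical lines in $\mathbb{R}^2$ each of which intersects this zero set in at least $n$ distinct points, then $p$ and $g$ have a common factor in $\mathbb{R}[x,y]$ with the same zero set as $p$ and $g$.
   Context: The zero set of $f\in\mathbb{R}[x,y]$ is $\{(a,b)\in\mathbb{R}^2 : f(a,b)=0\}$. $\deg_y p$ denotes the degree of $p$ in the variable $y$, i.e. the degree of $p$ viewed as a polynomial in $y$ with coefficients in $\mathbb{R}[x]$. A vertical line is a line $\{(x_0,y): y\in\mathbb{R}\}$ for some $x_0\in\mathbb{R}$. A common factor of $p$ and $g$ is a polynomial in $\mathbb{R}[x,y]$ dividing both $p$ and $g$ in $\mathbb{R}[x,y]$. *)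

theory Defs
  imports Complex_Main "HOL-Computational_Algebra.Computational_Algebra"
begin

text \<open>
  The ring of real polynomials in \<open>x\<close> and \<open>y\<close> is represented by \<^typ>\<open>real poly poly\<close>:
  the outer variable is \<open>y\<close> and the coefficients are polynomials in \<open>x\<close>.  Hence
  \<^const>\<open>degree\<close> is the degree in \<open>y\<close> (with value 0 for the zero polynomial), and
  \<^term>\<open>(dvd)\<close> on this type is divisibility in the bivariate polynomial ring.
\<close>

definition eval2 :: "real poly poly \<Rightarrow> real \<Rightarrow> real \<Rightarrow> real" where
  "eval2 f a b = poly (poly f [:b:]) a"

lemma eval2_altdef: "eval2 f a b = (\<Sum>i\<le>degree f. poly (coeff f i) a * b ^ i)"
  by (simp add: eval2_def poly_altdef[of f] poly_sum)

definition zero_set :: "real poly poly \<Rightarrow> (real \<times> real) set" where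
  "zero_set f = {(a, b). eval2 f a b = 0}"

definition vertical_line :: "(real \<times> real) set \<Rightarrow> bool" where
  "vertical_line L \<longleftrightarrow> (\<exists>x0. L = {(x0, y) |y. True})"

text \<open>
  The intersection with a line may be infinite, where \<^const>\<open>card\<close> would be 0;
  so the points are counted through finite subsets.
\<close>

definition has_at_least :: "nat \<Rightarrow> 'a set \<Rightarrow> bool" where
  "has_at_least n S \<longleftrightarrow> (\<exists>A. A \<subseteq> S \<and> finite A \<and> card A = n)"

end

theory Submission
  imports Defs "HOL-Computational_Algebra.Field_as_Ring"
begin

text \<open>
  Let \<open>d = gcd p g\<close>, \<open>p = d * p'\<close> and \<open>g = d * g'\<close>; then \<open>d\<close> is the desired factor.  As \<open>p'\<close> and
  \<open>g'\<close> are coprime, \<open>u * p' + v * g' = r\<close> for some nonzero \<open>r\<close> depending on \<open>x\<close> only.  If \<open>p'\<close> had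
  positive degree in \<open>y\<close>, then on each of the given vertical lines, up to finitely many, \<open>d\<close> would
  have fewer than \<open>n\<close> zeros, so some common zero of \<open>p\<close> and \<open>g\<close> would not be a zero of \<open>d\<close>; there
  \<open>p'\<close> and \<open>g'\<close> vanish, so \<open>r\<close> would have infinitely many roots.  Hence \<open>p'\<close> depends on \<open>x\<close> only
  and its zero set consists of vertical lines \<open>x = a\<close>; for each of them \<open>x - a\<close> divides both \<open>p\<close>
  and \<open>g\<close>, hence \<open>d\<close>.
\<close>

lemma eval2_mult: "eval2 (f * g) a b = eval2 f a b * eval2 g a b"
  by (simp add: eval2_def)

lemma eval2_add: "eval2 (f + g) a b = eval2 f a b + eval2 g a b"
  by (simp add: eval2_def)

lemma eval2_const: "eval2 [:c:] a b = poly c a"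
  by (simp add: eval2_def)

text \<open>Fixing \<open>x = a\<close> first gives a real polynomial in \<open>y\<close> alone, so
  univariate root counting applies. Its degree may drop, but the lost terms are zero at
  \<open>a\<close>.\<close>

lemma eval2_eq_poly_map_poly: "eval2 f a b = poly (map_poly (\<lambda>c. poly c a) f) b"
proof -
  let ?h = "map_poly (\<lambda>c. poly c a) f"
  have "poly ?h b = (\<Sum>i\<le>degree ?h. poly (coeff f i) a * b ^ i)"
    by (simp add: poly_altdef coeff_map_poly)
  also have "\<dots> = (\<Sum>i\<le>degree f. poly (coeff f i) a * b ^ i)"
  proof (rule sum.mono_neutral_left)
    show "\<forall>i\<in>{..degree f} - {..degree ?h}. poly (coeff f i) a * b ^ i = 0"
      using coeff_eq_0[of ?h] by (auto simp: coeff_map_poly)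
  qed (use map_poly_degree_leq[of "\<lambda>c. poly c a" f] in auto)
  finally show ?thesis by (simp add: eval2_altdef)
qed

lemma map_poly_eval_eq_0_iff:
  fixes f :: "real poly poly"
  shows "map_poly (\<lambda>c. poly c a) f = 0 \<longleftrightarrow> [:[:-a, 1:]:] dvd f"
  unfolding const_poly_dvd_iff poly_eq_0_iff_dvd[symmetric] by (simp add: poly_eq_iff coeff_map_poly)

lemma zero_on_vertical_line_iff: "(\<forall>b. eval2 f a b = 0) \<longleftrightarrow> [:[:-a, 1:]:] dvd f"
  by (simp add: eval2_eq_poly_map_poly poly_all_0_iff_0 map_poly_eval_eq_0_iff)

text \<open>If the line \<open>x = a\<close> lies in the zero set, then \<open>a\<close> is a root
  of every coefficient, in particular of the nonzero leading one.\<close>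

lemma finite_vertical_lines_in_zero_set:
  assumes "f \<noteq> 0"
  shows "finite {a. \<forall>b. eval2 f a b = 0}"
proof (rule finite_subset)
  show "{a. \<forall>b. eval2 f a b = 0} \<subseteq> {a. poly (lead_coeff f) a = 0}"
    by (auto simp: zero_on_vertical_line_iff const_poly_dvd_iff poly_eq_0_iff_dvd)
  show "finite {a. poly (lead_coeff f) a = 0}"
    using assms by (intro poly_roots_finite) auto
qed

lemma card_roots_on_vertical_line_le:
  assumes "\<not> (\<forall>b. eval2 f a b = 0)"
  shows "finite {b. eval2 f a b = 0}" "card {b. eval2 f a b = 0} \<le> degree f"
proof -
  have nz: "map_poly (\<lambda>c. poly c a) f \<noteq> 0"
    using assms by (auto simp: eval2_eq_poly_map_poly)
  show "finite {b. eval2 f a b = 0}"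
    unfolding eval2_eq_poly_map_poly by (rule poly_roots_finite[OF nz])
  show "card {b. eval2 f a b = 0} \<le> degree f"
    unfolding eval2_eq_poly_map_poly
    by (rule order.trans[OF card_poly_roots_bound[OF nz] map_poly_degree_leq])
qed

text \<open>By Gauss's lemma, taking primitive parts preserves divisibility, and scaling by
  \<open>c\<close> changes the primitive part only by a unit.\<close>

lemma primitive_part_dvd_if_dvd_smult:
  fixes f m :: "'a :: {factorial_ring_gcd, semiring_gcd_mult_normalize} poly"
  assumes "m dvd smult c f" "c \<noteq> 0"
  shows "primitive_part m dvd f"
proof -
  have "primitive_part m dvd primitive_part (smult c f)"
    using assms(1) by (rule primitive_part_dvd_primitive_partI)
  also have "\<dots> = smult (unit_factor c) (primitive_part f)"
    by (rule primitive_part_smult)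
  also have "\<dots> = [:unit_factor c:] * primitive_part f" by simp
  also have "\<dots> dvd primitive_part f"
    using assms(2) by (subst mult_unit_dvd_iff') (simp_all add: is_unit_const_poly_iff)
  also have "primitive_part f dvd f"
    using dvd_smult[OF dvd_refl, of "primitive_part f" "content f"] by simp
  finally show ?thesis .
qed

text \<open>
  A nonzero element of least degree in the ideal generated by \<open>f\<close> and \<open>g\<close> divides both up to
  constants by pseudo-division, so by Gauss's lemma its primitive part is a common factor.
\<close>
lemma coprime_elimination:
  fixes f g :: "'a :: {factorial_ring_gcd, semiring_gcd_mult_normalize} poly"
  assumes "coprime f g" "f \<noteq> 0"
  obtains u v r where "u * f + v * g = [:r:]" "r \<noteq> 0"
proof -
  define I where "I = {u * f + v * g | u v. True}"
  have add: "s + t \<in> I" and mult: "w * s \<in> I" if "s \<in> I" "t \<in> I" for s t w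
  proof -
    from that obtain u v u' v' where "s = u * f + v * g" "t = u' * f + v' * g"
      by (auto simp: I_def)
    then have "s + t = (u + u') * f + (v + v') * g" "w * s = (w * u) * f + (w * v) * g"
      by (auto simp: algebra_simps)
    then show "s + t \<in> I" "w * s \<in> I" unfolding I_def by blast+
  qed
  have f: "f \<in> I" unfolding I_def by (rule CollectI, rule exI[of _ 1], rule exI[of _ 0]) simp
  have g: "g \<in> I" unfolding I_def by (rule CollectI, rule exI[of _ 0], rule exI[of _ 1]) simp
  obtain m where m: "m \<in> I" "m \<noteq> 0" and
    least: "\<And>s. s \<in> I \<Longrightarrow> s \<noteq> 0 \<Longrightarrow> degree m \<le> degree s"
    using ex_has_least_nat[of "\<lambda>s. s \<in> I \<and> s \<noteq> 0" f degree] f assms(2) by auto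
  have dvd: "primitive_part m dvd s" if s: "s \<in> I" for s
  proof -
    obtain q r where qr: "pseudo_divmod s m = (q, r)" by (cases "pseudo_divmod s m")
    define c where "c = lead_coeff m ^ (Suc (degree s) - degree m)"
    have c: "c \<noteq> 0" using m by (simp add: c_def)
    from pseudo_divmod[OF m(2) qr] have
      eq: "smult c s = m * q + r" and r: "r = 0 \<or> degree r < degree m" by (auto simp: c_def)
    have "r = [:c:] * s + (- q) * m" using eq by (simp add: algebra_simps)
    then have "r \<in> I" using add[OF mult[OF s s, of "[:c:]"] mult[OF m(1) m(1), of "- q"]] by simp
    then have "r = 0" using least r by force
    then show ?thesis using eq c by (intro primitive_part_dvd_if_dvd_smult[of m c]) auto
  qed
  have "is_unit (primitive_part m)"
    using assms(1) dvd[OF f] dvd[OF g] by (rule coprime_common_divisor)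
  \<comment> \<open>Dividing out the content does not change the degree, and units have degree
    0.\<close>
  then have "degree m = 0"
    using degree_primitive_part[of m] by (elim is_unit_polyE) simp
  then obtain r where "m = [:r:]" by (rule degree_eq_zeroE)
  with m obtain u v where "u * f + v * g = [:r:]" "r \<noteq> 0" by (auto simp: I_def)
  then show ?thesis by (rule that)
qed

text \<open>A vertical line is determined by its abscissa, and \<open>snd\<close> is injective on
  it, so point counts carry over to ordinates.\<close>

lemma infinite_vertical_lines_abscissae:
  assumes "infinite {L. vertical_line L \<and> has_at_least n (L \<inter> zero_set p)}"
  shows "infinite {a. has_at_least n {b. eval2 p a b = 0}}"
proof
  assume fin: "finite {a. has_at_least n {b. eval2 p a b = 0}}"
  have "{L. vertical_line L \<and> has_at_least n (L \<inter> zero_set p)} \<subseteq>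
      (\<lambda>a. {(a, y) | y. True}) ` {a. has_at_least n {b. eval2 p a b = 0}}"
  proof clarify
    fix L assume "vertical_line L" and n: "has_at_least n (L \<inter> zero_set p)"
    then obtain a where L: "L = {(a, y) | y. True}" by (auto simp: vertical_line_def)
    from n obtain A where A: "A \<subseteq> L \<inter> zero_set p" "finite A" "card A = n"
      by (auto simp: has_at_least_def)
    have "inj_on snd A" using A(1) by (auto simp: L inj_on_def)
    then have "has_at_least n {b. eval2 p a b = 0}"
      unfolding has_at_least_def using A
      by (intro exI[of _ "snd ` A"]) (auto simp: card_image L zero_set_def)
    then show "L \<in> (\<lambda>a. {(a, y) | y. True}) ` {a. has_at_least n {b. eval2 p a b = 0}}"
      using L by blast
  qed
  with fin assms show False by (meson finite_imageI finite_subset)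
qed

theorem theorem8:
  fixes p g :: "real poly poly" and n :: nat
  assumes "zero_set p = zero_set g"
    and "n = degree p"
    and "infinite {L. vertical_line L \<and> has_at_least n (L \<inter> zero_set p)}"
  shows "\<exists>h. h dvd p \<and> h dvd g \<and> zero_set h = zero_set p \<and> zero_set h = zero_set g"
proof (cases "p = 0")
  case True
  \<comment> \<open>Everything divides 0, so \<open>g\<close> itself serves as the common
    factor.\<close>
  then show ?thesis using assms(1) by (intro exI[of _ g]) auto
next
  case False
  have zeros: "eval2 p a b = 0 \<longleftrightarrow> eval2 g a b = 0" for a b
    using assms(1) by (auto simp: zero_set_def)
  define d where "d = gcd p g"
  obtain p' g' where p: "p = d * p'" and g: "g = d * g'"
    unfolding d_def by (meson dvdE gcd_dvd1 gcd_dvd2)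
  have nz: "d \<noteq> 0" "p' \<noteq> 0" using False p by auto
  have "coprime p' g'"
  proof (rule gcd_coprime)
    show "p = p' * gcd p g" by (subst mult.commute) (fact p[unfolded d_def])
    show "g = g' * gcd p g" by (subst mult.commute) (fact g[unfolded d_def])
  qed (use False in simp)
  then obtain u v r where uvr: "u * p' + v * g' = [:r:]" "r \<noteq> 0"
    using nz coprime_elimination by blast
  have "degree p' = 0"
  proof (rule ccontr)
    assume "degree p' \<noteq> 0"
    then have deg: "degree d < n" using assms(2) nz by (simp add: p degree_mult_eq)
    have "{a. has_at_least n {b. eval2 p a b = 0}} \<subseteq>
        {a. \<forall>b. eval2 d a b = 0} \<union> {a. poly r a = 0}"
    proof clarify
      fix a b' assume "has_at_least n {b. eval2 p a b = 0}" and "poly r a \<noteq> 0"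
      show "eval2 d a b' = 0"
      proof (rule ccontr)
        assume "eval2 d a b' \<noteq> 0"
        then have d: "finite {b. eval2 d a b = 0}" "card {b. eval2 d a b = 0} \<le> degree d"
          using card_roots_on_vertical_line_le[of d a] by auto
        obtain A where A: "A \<subseteq> {b. eval2 p a b = 0}" "finite A" "card A = n"
          using \<open>has_at_least n _\<close> by (auto simp: has_at_least_def)
        \<comment> \<open>Pigeonhole: \<open>A\<close> has \<open>n\<close> elements, but
          \<open>d\<close> has at most \<open>degree d < n\<close> zeros on this line.\<close>
        have "\<not> A \<subseteq> {b. eval2 d a b = 0}"
          using card_mono[OF d(1), of A] d(2) deg A(3) by linarith
        then obtain b where b: "eval2 p a b = 0" "eval2 d a b \<noteq> 0" using A(1) by auto
        \<comment> \<open>The equal zero sets make \<open>g\<close> vanish here too, and the nonzero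
          value of \<open>d\<close> cancels.\<close>
        then have "eval2 p' a b = 0" "eval2 g' a b = 0"
          using zeros[of a b] by (simp_all add: p g eval2_mult)
        then have "eval2 [:r:] a b = 0"
          by (simp add: uvr(1)[symmetric] eval2_add eval2_mult)
        then show False using \<open>poly r a \<noteq> 0\<close> by (simp add: eval2_const)
      qed
    qed
    moreover have "finite ({a. \<forall>b. eval2 d a b = 0} \<union> {a. poly r a = 0})"
      using finite_vertical_lines_in_zero_set[OF nz(1)] poly_roots_finite[OF uvr(2)] by simp
    ultimately show False
      using infinite_vertical_lines_abscissae[OF assms(3)] finite_subset by blast
  qed
  then obtain c where c: "p' = [:c:]" by (rule degree_eq_zeroE)
  have factored: "eval2 p a b = eval2 d a b * poly c a" for a b
    unfolding p eval2_mult c eval2_const ..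
  have "eval2 d a b = 0 \<longleftrightarrow> eval2 p a b = 0" for a b
  proof
    assume "eval2 p a b = 0"
    then consider "eval2 d a b = 0" | "poly c a = 0"
      by (auto simp: factored)
    then show "eval2 d a b = 0"
    proof cases
      case 2
      then have line: "\<forall>b. eval2 p a b = 0" by (simp add: factored)
      then have "\<forall>b. eval2 g a b = 0" using zeros by simp
      with line have "[:[:-a, 1:]:] dvd d"
        unfolding d_def zero_on_vertical_line_iff by (rule gcd_greatest)
      then show ?thesis by (simp flip: zero_on_vertical_line_iff)
    qed
  qed (simp add: factored)
  then have "zero_set d = zero_set p" by (auto simp: zero_set_def)
  moreover have "d dvd p" "d dvd g" by (simp_all add: d_def)
  ultimately show ?thesis using assms(1) by auto
qed

end
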